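(* Let $X$ be a normed space, let $F\subset X$ be a closed, bounded, convex set containing the origin as an interior point, let $\Omega_1,\ldots,\Omega_n\subset X$ ($n\ge 1$) be nonempty closed bounded sets, and let $\Omega\subset X$ be a nonempty closed set. Suppose that one of the following holds: (i) $\Omega$ is a nonempty compact set; (ii) $X$ is a reflexive Banach space and $\Omega$ is weakly closed. Then the smallest enclosing ball problem has a solution; that is, there exist $\bar x\in\Omega$ and $r\ge 0$ such that $$\Omega_i\subset \bar x+rF\quad\text{for } i=1,\ldots,n,$$ and for any $x\in\Omega$ and $t\ge 0$ such that $\Omega_i\subset x+tF$ for $i=1,\ldots,n$, one has $r\le t$.
   Context: For $x\in X$ and $r\geq 0$, $x+rF=\{x+rf: f\in F\}$. The smallest enclosing ball problem asks for a point $\bar x\in\Omega$ and the smallest $r\ge 0$ such that $\bar x+rF$ contains all of the target sets $\Omega_1,\ldots,\Omega_n$, with the meaning of "solution" spelled out in the claim. *)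

theory Defs
  imports "HOL-Analysis.Analysis"
begin

definition dilate :: "'a::real_normed_vector \<Rightarrow> real \<Rightarrow> 'a set \<Rightarrow> 'a set" where
  "dilate x r F = {x + r *\<^sub>R f |f. f \<in> F}"

lift_definition bidual_embedding ::
    "'a::real_normed_vector \<Rightarrow> (('a \<Rightarrow>\<^sub>L real) \<Rightarrow>\<^sub>L real)" is
  "\<lambda>x f. blinfun_apply f x"
  by (rule blinfun.bounded_linear_left)

text \<open>Completeness is required explicitly, because reflexivity is only one alternative
  of a hypothesis on a space that is otherwise an arbitrary normed space.\<close>

definition reflexive_banach :: "'a::real_normed_vector itself \<Rightarrow> bool" where
  "reflexive_banach (_ :: 'a itself) \<longleftrightarrow>
     complete (UNIV :: 'a set) \<and>
     surj (bidual_embedding :: 'a \<Rightarrow> (('a \<Rightarrow>\<^sub>L real) \<Rightarrow>\<^sub>L real))"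

definition weak_topology :: "'a::real_normed_vector topology" where
  "weak_topology = topology_generated_by
     {blinfun_apply f -` U |(f :: 'a \<Rightarrow>\<^sub>L real) U. open U}"

end

(* A point z lies in x + r F exactly when f z - f x <= r for every functional f in the polar of F;
   this follows by Hahn-Banach applied to the Minkowski gauge of F, and boundedness of F makes it
   true even for r = 0.  Hence the set C t of admissible centres for radius t is weakly closed,
   bounded, and increasing in t.  Under either alternative the intersection of Omega and C t is
   weakly compact (in the reflexive case by Tychonoff in the product of the intervals
   [- M |f|, M |f|]), so the finite intersection property gives a point of Omega that lies in C t
   for all feasible t; it then lies in C r for the infimum r of the feasible t. *)

theory Submission
  imports Defs
begin

section \<open>Sublinear functionals and the Hahn-Banach theorem\<close>

definition sublinear :: "('a::real_vector \<Rightarrow> real) \<Rightarrow> bool" where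
  "sublinear p \<longleftrightarrow> (\<forall>x y. p (x + y) \<le> p x + p y) \<and> (\<forall>c x. 0 < c \<longrightarrow> p (c *\<^sub>R x) = c * p x)"

text \<open>Applying the inequality to \<open>inverse c\<close> and \<open>c *\<^sub>R x\<close>
  gives its converse, so for functionals defined by infima only one half of homogeneity has to be
  checked.\<close>

lemma sublinearI:
  assumes "\<And>x y. p (x + y) \<le> p x + p y"
    and le: "\<And>c x. 0 < c \<Longrightarrow> p (c *\<^sub>R x) \<le> c * p x"
  shows "sublinear p"
  unfolding sublinear_def
proof (intro conjI allI impI antisym)
  fix c :: real and x assume c: "0 < c"
  have "p (inverse c *\<^sub>R (c *\<^sub>R x)) \<le> inverse c * p (c *\<^sub>R x)"
    using c by (intro le) simp
  with c show "c * p x \<le> p (c *\<^sub>R x)"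
    by (simp add: field_simps)
qed (use assms in auto)

lemma sublinear_add: "sublinear p \<Longrightarrow> p (x + y) \<le> p x + p y"
  by (simp add: sublinear_def)

lemma sublinear_0:
  assumes "sublinear p" shows "p 0 = 0"
proof -
  have "p (2 *\<^sub>R 0) = 2 * p 0"
    using assms unfolding sublinear_def by (metis zero_less_numeral)
  then show ?thesis by simp
qed

lemma sublinear_scale: "sublinear p \<Longrightarrow> 0 \<le> c \<Longrightarrow> p (c *\<^sub>R x) = c * p x"
  by (cases "c = 0") (auto simp: sublinear_0, auto simp: sublinear_def)

lemma sublinear_minus_ge: "sublinear p \<Longrightarrow> - p (- x) \<le> p x"
  using sublinear_add[of p x "- x"] by (simp add: sublinear_0)

text \<open>The functional \<open>q\<close> is an infimum over \<open>t \<ge> 0\<close> whose terms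
  at \<open>t = 0\<close> and \<open>t = 1\<close> are the two upper bounds. If \<open>p\<close> is
  minimal, then \<open>q = p\<close>, and the second bound makes \<open>p\<close> superadditive in
  the direction \<open>y\<close>.\<close>

lemma sublinear_directional:
  fixes p :: "'a::real_vector \<Rightarrow> real"
  assumes p: "sublinear p"
  obtains q where "sublinear q" "\<And>x. q x \<le> p x" "\<And>x. q x \<le> p (x + y) - p y"
proof -
  define q where "q x = (INF t\<in>{0..}. p (x + t *\<^sub>R y) - t * p y)" for x
  \<comment> \<open>A lower bound independent of \<open>t\<close>, so that the real infimum is
    genuine.\<close>
  have "- p (- x) \<le> p (x + t *\<^sub>R y) - t * p y" if "0 \<le> t" for x t
    using sublinear_add[OF p, of "x + t *\<^sub>R y" "- x"] sublinear_scale[OF p that, of y] by simp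
  then have bdd: "bdd_below ((\<lambda>t. p (x + t *\<^sub>R y) - t * p y) ` {0..})" for x
    by (intro bdd_belowI2) auto
  have q_le: "q x \<le> p (x + t *\<^sub>R y) - t * p y" if "0 \<le> t" for x t
    unfolding q_def using that by (intro cINF_lower bdd) auto
  have q_ge: "u \<le> q x" if "\<And>t. 0 \<le> t \<Longrightarrow> u \<le> p (x + t *\<^sub>R y) - t * p y" for x u
    unfolding q_def using that by (intro cINF_greatest) auto
  have "sublinear q"
  proof (rule sublinearI)
    fix x z
    \<comment> \<open>Parameters \<open>s\<close> for \<open>x\<close> and \<open>t\<close> for
      \<open>z\<close> are combined into \<open>s + t\<close> for \<open>x + z\<close>; the two
      infima are then taken one after the other.\<close>
    have "q (x + z) - q x \<le> q z"
    proof (rule q_ge)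
      fix t :: real assume t: "0 \<le> t"
      have "q (x + z) - (p (z + t *\<^sub>R y) - t * p y) \<le> q x"
      proof (rule q_ge)
        fix s :: real assume s: "0 \<le> s"
        have "q (x + z) \<le> p (x + z + (s + t) *\<^sub>R y) - (s + t) * p y"
          using s t by (intro q_le) simp
        also have "x + z + (s + t) *\<^sub>R y = (x + s *\<^sub>R y) + (z + t *\<^sub>R y)"
          by (simp add: algebra_simps)
        finally show "q (x + z) - (p (z + t *\<^sub>R y) - t * p y) \<le> p (x + s *\<^sub>R y) - s * p y"
          using sublinear_add[OF p, of "x + s *\<^sub>R y" "z + t *\<^sub>R y"] by (simp add: algebra_simps)
      qed
      then show "q (x + z) - q x \<le> p (z + t *\<^sub>R y) - t * p y" by simp
    qed
    then show "q (x + z) \<le> q x + q z" by simp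
  next
    fix c :: real and x assume c: "0 < c"
    have "q (c *\<^sub>R x) / c \<le> q x"
    proof (rule q_ge)
      fix t :: real assume "0 \<le> t"
      with c have "q (c *\<^sub>R x) \<le> p (c *\<^sub>R x + (c * t) *\<^sub>R y) - (c * t) * p y"
        by (intro q_le) simp
      also have "\<dots> = c * (p (x + t *\<^sub>R y) - t * p y)"
        using sublinear_scale[OF p, of c "x + t *\<^sub>R y"] c by (simp add: algebra_simps)
      finally show "q (c *\<^sub>R x) / c \<le> p (x + t *\<^sub>R y) - t * p y"
        using c by (simp add: field_simps)
    qed
    with c show "q (c *\<^sub>R x) \<le> c * q x" by (simp add: field_simps)
  qed
  moreover have "q x \<le> p x" for x using q_le[of 0 x] by simp
  moreover have "q x \<le> p (x + y) - p y" for x using q_le[of 1 x] by simp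
  ultimately show ?thesis using that by blast
qed

text \<open>Comparability is what gives subadditivity: two members \<open>q\<close> and
  \<open>q'\<close> can both be replaced by the smaller one. The common bound
  \<open>- p (- x)\<close> keeps the infimum finite.\<close>

lemma sublinear_INF_chain:
  fixes C :: "('a::real_vector \<Rightarrow> real) set"
  assumes "C \<noteq> {}" and sub: "\<And>q. q \<in> C \<Longrightarrow> sublinear q \<and> q \<le> p"
    and chain: "\<And>q q'. q \<in> C \<Longrightarrow> q' \<in> C \<Longrightarrow> q \<le> q' \<or> q' \<le> q"
  shows "sublinear (\<lambda>x. INF q\<in>C. q x)" "\<And>q x. q \<in> C \<Longrightarrow> (INF q\<in>C. q x) \<le> q x"
proof -
  define m where "m x = (INF q\<in>C. q x)" for x
  have "- p (- x) \<le> q x" if "q \<in> C" for q x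
    using sub[OF that] sublinear_minus_ge[of q x] by (auto simp: le_fun_def dest!: spec[of _ "- x"])
  then have bdd: "bdd_below ((\<lambda>q. q x) ` C)" for x
    by (intro bdd_belowI2) auto
  then have m_le: "m x \<le> q x" if "q \<in> C" for q x
    unfolding m_def using that by (intro cINF_lower) auto
  then show "\<And>q x. q \<in> C \<Longrightarrow> (INF q\<in>C. q x) \<le> q x"
    by (simp add: m_def)
  have m_ge: "u \<le> m x" if "\<And>q. q \<in> C \<Longrightarrow> u \<le> q x" for x u
    unfolding m_def using that \<open>C \<noteq> {}\<close> by (intro cINF_greatest) auto
  have "sublinear m"
  proof (rule sublinearI)
    fix x z
    have "m (x + z) - m x \<le> m z"
    proof (rule m_ge)
      fix q' assume q': "q' \<in> C"
      have "m (x + z) - q' z \<le> m x"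
      proof (rule m_ge)
        fix q assume q: "q \<in> C"
        obtain r where r: "r \<in> C" "r \<le> q" "r \<le> q'"
          using chain[OF q q'] q q' by blast
        have "m (x + z) \<le> r (x + z)" using r by (intro m_le)
        also have "\<dots> \<le> r x + r z" using sub[OF \<open>r \<in> C\<close>] by (blast intro: sublinear_add)
        also have "\<dots> \<le> q x + q' z" using r by (intro add_mono) (auto simp: le_fun_def)
        finally show "m (x + z) - q' z \<le> q x" by simp
      qed
      then show "m (x + z) - m x \<le> q' z" by simp
    qed
    then show "m (x + z) \<le> m x + m z" by simp
  next
    fix c :: real and x assume c: "0 < c"
    have "m (c *\<^sub>R x) / c \<le> m x"
    proof (rule m_ge)
      fix q assume q: "q \<in> C"
      then have "m (c *\<^sub>R x) \<le> c * q x"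
        using m_le[OF q, of "c *\<^sub>R x"] sub[OF q] c by (simp add: sublinear_scale)
      with c show "m (c *\<^sub>R x) / c \<le> q x" by (simp add: field_simps)
    qed
    with c show "m (c *\<^sub>R x) \<le> c * m x" by (simp add: field_simps)
  qed
  then show "sublinear (\<lambda>x. INF q\<in>C. q x)"
    by (simp add: m_def[abs_def])
qed

text \<open>A pointwise minimal sublinear functional is linear, since its directional modification cannot
  be smaller.  Modifying \<open>p\<close> along \<open>y\<close> first forces equality at \<open>y\<close>.\<close>

theorem Hahn_Banach_sublinear:
  fixes p :: "'a::real_vector \<Rightarrow> real"
  assumes p: "sublinear p"
  obtains f where "linear f" "\<And>x. f x \<le> p x" "f y = p y"
proof -
  obtain p' where p': "sublinear p'" "\<And>x. p' x \<le> p x" "\<And>x. p' x \<le> p (x + y) - p y"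
    using sublinear_directional[OF p] by blast
  define A where "A = {q. sublinear q \<and> q \<le> p'}"
  \<comment> \<open>Zorn's lemma for the reversed order: the upper bound of a chain is its pointwise
    infimum, and \<open>p'\<close> serves the empty chain.\<close>
  have "\<exists>m\<in>A. \<forall>a\<in>A. m \<ge> a \<longrightarrow> a = m"
  proof (rule predicate_Zorn)
    show "partial_order_on A (relation_of (\<ge>) A)"
      by (rule partial_order_on_relation_ofI) auto
    fix C assume C: "C \<in> Chains (relation_of (\<ge>) A)"
    show "\<exists>u\<in>A. \<forall>a\<in>C. a \<ge> u"
    proof (cases "C = {}")
      case True
      then show ?thesis using p' by (auto simp: A_def)
    next
      case False
      have sub: "sublinear q \<and> q \<le> p'" if "q \<in> C" for q
        using Chains_relation_of[OF C] that by (auto simp: A_def)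
      have chain: "q \<le> q' \<or> q' \<le> q" if "q \<in> C" "q' \<in> C" for q q'
        using C that by (auto simp: Chains_def relation_of_def)
      have INF: "sublinear (\<lambda>x. INF q\<in>C. q x)" "\<And>q x. q \<in> C \<Longrightarrow> (INF q\<in>C. q x) \<le> q x"
        using sublinear_INF_chain[OF False, of p'] sub chain by metis+
      obtain q where q: "q \<in> C" using False by blast
      have "(INF q\<in>C. q x) \<le> p' x" for x
        using INF(2)[OF q, of x] le_funD[of q p' x] sub[OF q] by linarith
      with INF(1) have "(\<lambda>x. INF q\<in>C. q x) \<in> A"
        by (simp add: A_def le_fun_def)
      moreover have "(\<lambda>x. INF q\<in>C. q x) \<le> q" if "q \<in> C" for q
        using INF(2)[OF that] by (rule le_funI)
      ultimately show ?thesis by blast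
    qed
  qed
  then obtain f where f: "sublinear f" "f \<le> p'"
    and min: "\<And>q. sublinear q \<Longrightarrow> q \<le> p' \<Longrightarrow> q \<le> f \<Longrightarrow> q = f"
    by (auto simp: A_def)
  have add: "f (x + z) = f x + f z" for x z
  proof -
    obtain q where q: "sublinear q" "\<And>x. q x \<le> f x" "\<And>x. q x \<le> f (x + z) - f z"
      using sublinear_directional[OF f(1)] by blast
    then have "q \<le> f" by (intro le_funI)
    with f(2) q(1) have "q = f" by (intro min order_trans[of q f p'])
    with q(3)[of x] sublinear_add[OF f(1), of x z] show ?thesis by simp
  qed
  have minus: "f (- x) = - f x" for x
    using add[of x "- x"] sublinear_0[OF f(1)] by simp
  have "f (c *\<^sub>R x) = c * f x" for c x
    using sublinear_scale[OF f(1), of c x] sublinear_scale[OF f(1), of "- c" x] minus[of "c *\<^sub>R x"]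
    by (cases "0 \<le> c") auto
  with add have "linear f" by (intro linearI) auto
  moreover have "f x \<le> p x" for x
    using le_funD[OF f(2)] p'(2) order_trans by blast
  moreover have "f y = p y"
  proof -
    \<comment> \<open>At \<open>- y\<close> the directional bound reads
      \<open>p' (- y) \<le> p 0 - p y\<close>, with \<open>p 0 = 0\<close>.\<close>
    have "- f y \<le> - p y"
      using le_funD[OF f(2), of "- y"] p'(3)[of "- y"] sublinear_0[OF p] minus[of y] by simp
    with calculation(2)[of y] show ?thesis by simp
  qed
  ultimately show ?thesis using that by blast
qed

section \<open>Polar sets, separation, and the dual description of dilates\<close>

text \<open>The one-sided polar, without an absolute value, because \<open>F\<close> may be
  asymmetric.\<close>

definition polar :: "'a::real_normed_vector set \<Rightarrow> ('a \<Rightarrow>\<^sub>L real) set" where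
  "polar F = {f. \<forall>x\<in>F. blinfun_apply f x \<le> 1}"

text \<open>Hahn-Banach is applied to the Minkowski gauge \<open>g\<close> of \<open>F\<close>: it
  yields \<open>f \<le> g \<le> 1\<close> on \<open>F\<close> and \<open>f y = g y > 1\<close>. A
  ball of radius \<open>d\<close> inside \<open>F\<close> gives \<open>g x \<le> norm x / d\<close>,
  hence continuity of \<open>f\<close>.\<close>

lemma separation_closed_convex:
  fixes F :: "'a::real_normed_vector set"
  assumes "closed F" "convex F" "0 \<in> interior F" "y \<notin> F"
  obtains f where "f \<in> polar F" "1 < blinfun_apply f y"
proof -
  obtain d where d: "0 < d" "cball 0 d \<subseteq> F"
    using \<open>0 \<in> interior F\<close> by (auto simp: mem_interior_cball)
  then have "0 \<in> F" by auto
  have absorb: "x /\<^sub>R t \<in> F" if "0 < t" "norm x / d \<le> t" for x t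
    using that d by (intro subsetD[OF d(2)]) (auto simp: field_simps)
  define g where "g x = Inf {t. 0 < t \<and> x /\<^sub>R t \<in> F}" for x
  have g_le: "g x \<le> t" if "0 < t" "x /\<^sub>R t \<in> F" for x t
    unfolding g_def using that by (intro cInf_lower) (auto intro!: bdd_belowI[of _ 0])
  have g_ge: "u \<le> g x" if "\<And>t. 0 < t \<Longrightarrow> x /\<^sub>R t \<in> F \<Longrightarrow> u \<le> t" for x u
  proof -
    have "0 < norm x / d + 1"
      using d by (intro add_nonneg_pos) auto
    then have "norm x / d + 1 \<in> {t. 0 < t \<and> x /\<^sub>R t \<in> F}"
      using absorb[of "norm x / d + 1" x] by simp
    then show ?thesis
      unfolding g_def using that by (intro cInf_greatest) blast+
  qed
  have "sublinear g"
  proof (rule sublinearI)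
    fix x z
    have "g (x + z) - g x \<le> g z"
    proof (rule g_ge)
      fix t assume t: "0 < t" "z /\<^sub>R t \<in> F"
      have "g (x + z) - t \<le> g x"
      proof (rule g_ge)
        fix s assume s: "0 < s" "x /\<^sub>R s \<in> F"
        \<comment> \<open>Convexity with these weights puts \<open>(x + z) /\<^sub>R (s + t)\<close>
          into \<open>F\<close>, which is subadditivity of the gauge.\<close>
        have "(s / (s + t)) *\<^sub>R (x /\<^sub>R s) + (t / (s + t)) *\<^sub>R (z /\<^sub>R t) \<in> F"
          using s t \<open>convex F\<close> by (intro convexD) (auto simp: add_divide_distrib[symmetric])
        also have "(s / (s + t)) *\<^sub>R (x /\<^sub>R s) + (t / (s + t)) *\<^sub>R (z /\<^sub>R t) = (x + z) /\<^sub>R (s + t)"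
          using s t by (simp add: scaleR_add_right divide_simps)
        finally show "g (x + z) - t \<le> s"
          using g_le[of "s + t" "x + z"] s t by simp
      qed
      then show "g (x + z) - g x \<le> t" by simp
    qed
    then show "g (x + z) \<le> g x + g z" by simp
  next
    fix c :: real and x assume c: "0 < c"
    have "g (c *\<^sub>R x) / c \<le> g x"
    proof (rule g_ge)
      fix t assume t: "0 < t" "x /\<^sub>R t \<in> F"
      have "g (c *\<^sub>R x) \<le> c * t"
        using c t by (intro g_le) (auto simp: field_simps)
      with c show "g (c *\<^sub>R x) / c \<le> t" by (simp add: field_simps)
    qed
    with c show "g (c *\<^sub>R x) \<le> c * g x" by (simp add: field_simps)
  qed
  then obtain f where f: "linear f" "\<And>x. f x \<le> g x" "f y = g y"
    using Hahn_Banach_sublinear by blast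
  have "g x \<le> norm x / d" for x
  proof (rule field_le_epsilon)
    fix e :: real assume "0 < e"
    with d show "g x \<le> norm x / d + e"
      by (intro g_le absorb) (auto intro: add_nonneg_pos)
  qed
  then have f_le: "f x \<le> norm x / d" for x
    using f(2) order_trans by blast
  have "norm (f x) \<le> norm x * (1 / d)" for x
    using f_le[of x] f_le[of "- x"] by (simp add: linear_neg[OF f(1)] abs_le_iff)
  then have f_blinfun: "blinfun_apply (Blinfun f) = f"
    using f(1) by (intro bounded_linear_Blinfun_apply bounded_linear_intro[where K = "1 / d"])
      (simp_all add: linear_add[OF f(1)] linear_scale[OF f(1)])
  \<comment> \<open>Closedness provides the margin for a strict inequality: otherwise
    \<open>s\<close> could tend to 1 from above and \<open>y\<close> would lie in
    \<open>F\<close>.\<close>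
  have "\<exists>s>1. y /\<^sub>R s \<notin> F"
  proof (rule ccontr)
    assume "\<not> (\<exists>s>1. y /\<^sub>R s \<notin> F)"
    then have "\<forall>\<^sub>F s in at_right 1. y /\<^sub>R s \<in> F"
      by (auto simp: eventually_at_filter)
    moreover have "((\<lambda>s. y /\<^sub>R s) \<longlongrightarrow> y /\<^sub>R 1) (at_right 1)"
      by (intro tendsto_intros) auto
    ultimately have "y /\<^sub>R 1 \<in> F"
      using \<open>closed F\<close> by (intro Lim_in_closed_set) auto
    with \<open>y \<notin> F\<close> show False by simp
  qed
  then obtain s where s: "1 < s" "y /\<^sub>R s \<notin> F" by blast
  have "s \<le> g y"
  proof (rule g_ge)
    fix t assume t: "0 < t" "y /\<^sub>R t \<in> F"
    show "s \<le> t"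
    proof (rule ccontr)
      assume "\<not> s \<le> t"
      \<comment> \<open>This point of the segment from 0 to \<open>y /\<^sub>R t\<close> is
        \<open>y /\<^sub>R s\<close>, which lies outside \<open>F\<close>.\<close>
      then have "(t / s) *\<^sub>R (y /\<^sub>R t) + (1 - t / s) *\<^sub>R 0 \<in> F"
        using s t \<open>0 \<in> F\<close> \<open>convex F\<close> by (intro convexD) auto
      with s t show False by (simp add: divide_simps)
    qed
  qed
  with s f(3) have "1 < Blinfun f y" by (simp add: f_blinfun)
  moreover have "f x \<le> 1" if "x \<in> F" for x
    using f(2)[of x] g_le[of 1 x] that by simp
  then have "Blinfun f \<in> polar F"
    by (simp add: polar_def f_blinfun)
  ultimately show ?thesis using that by blast
qed

text \<open>For \<open>r > 0\<close>, a failure of membership is detected by separating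
  \<open>(z - x) /\<^sub>R r\<close> from \<open>F\<close>. For \<open>r = 0\<close> the dilate is
  \<open>{x}\<close>; if \<open>z \<noteq> x\<close>, boundedness lets a large multiple of
  \<open>z - x\<close> leave \<open>F\<close>, and separating it contradicts the
  inequalities.\<close>

lemma mem_dilate_iff_polar:
  fixes F :: "'a::real_normed_vector set"
  assumes F: "closed F" "bounded F" "convex F" "0 \<in> interior F" and "0 \<le> r"
  shows "z \<in> dilate x r F \<longleftrightarrow> (\<forall>f\<in>polar F. blinfun_apply f z - f x \<le> r)"
proof
  assume "z \<in> dilate x r F"
  then obtain h where "h \<in> F" "z = x + r *\<^sub>R h" by (auto simp: dilate_def)
  with \<open>0 \<le> r\<close> show "\<forall>f\<in>polar F. blinfun_apply f z - f x \<le> r"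
    by (auto simp: polar_def blinfun.add_right blinfun.scaleR_right mult_left_le)
next
  assume le: "\<forall>f\<in>polar F. blinfun_apply f z - f x \<le> r"
  show "z \<in> dilate x r F"
  proof (cases "r = 0")
    case False
    with \<open>0 \<le> r\<close> have r: "0 < r" by simp
    have "(z - x) /\<^sub>R r \<in> F"
    proof (rule ccontr)
      assume notin: "(z - x) /\<^sub>R r \<notin> F"
      obtain f where f: "f \<in> polar F" "1 < blinfun_apply f ((z - x) /\<^sub>R r)"
        by (rule separation_closed_convex[OF F(1,3,4) notin])
      then have "r < f z - f x"
        using r by (simp add: blinfun.diff_right blinfun.scaleR_right field_simps)
      with le f(1) show False by force
    qed
    moreover have "z = x + r *\<^sub>R ((z - x) /\<^sub>R r)" using r by simp
    ultimately show ?thesis unfolding dilate_def by blast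
  next
    case True
    have "z = x"
    proof (rule ccontr)
      assume "z \<noteq> x"
      obtain B where B: "0 < B" "\<And>y. y \<in> F \<Longrightarrow> norm y \<le> B"
        using \<open>bounded F\<close> by (auto simp: bounded_pos)
      \<comment> \<open>Scales \<open>z - x\<close> to norm \<open>2 * B\<close>, beyond the bound
        \<open>B\<close> for \<open>F\<close>.\<close>
      define k where "k = 2 * B / norm (z - x)"
      have k: "0 < k" "norm (k *\<^sub>R (z - x)) = 2 * B"
        using B \<open>z \<noteq> x\<close> by (auto simp: k_def)
      then have notin: "k *\<^sub>R (z - x) \<notin> F"
        using B(1) B(2)[of "k *\<^sub>R (z - x)"] by auto
      obtain f where f: "f \<in> polar F" "1 < blinfun_apply f (k *\<^sub>R (z - x))"
        by (rule separation_closed_convex[OF F(1,3,4) notin])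
      then have "f z - f x \<le> 0" using le True by blast
      then have "k * (f z - f x) \<le> 0" using k by (simp add: mult_nonneg_nonpos)
      with f(2) show False by (simp add: blinfun.diff_right blinfun.scaleR_right)
    qed
    moreover have "0 \<in> F" using F(4) interior_subset by blast
    ultimately show ?thesis using True by (auto simp: dilate_def)
  qed
qed

text \<open>The dual description for the unit ball with radius 0, where the dilate collapses to its
  centre.\<close>

lemma blinfun_separates_points:
  fixes x y :: "'a::real_normed_vector"
  assumes "\<And>f :: 'a \<Rightarrow>\<^sub>L real. f x = f y"
  shows "x = y"
proof -
  have "0 \<in> interior (cball (0 :: 'a) 1)"
    unfolding mem_interior_cball using zero_less_one by blast
  moreover have "blinfun_apply f y - f x \<le> 0" for f :: "'a \<Rightarrow>\<^sub>L real"
    using assms[of f] by simp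
  ultimately have "y \<in> dilate x 0 (cball 0 1)"
    by (simp add: mem_dilate_iff_polar)
  then show ?thesis by (auto simp: dilate_def)
qed

section \<open>The weak topology and weak compactness\<close>

lemma Union_weak_subbase: "\<Union> {blinfun_apply f -` U |(f :: 'a::real_normed_vector \<Rightarrow>\<^sub>L real) U. open U} = UNIV"
proof -
  have "blinfun_apply (0 :: 'a \<Rightarrow>\<^sub>L real) -` UNIV \<in> {blinfun_apply f -` U |(f :: 'a \<Rightarrow>\<^sub>L real) U. open U}"
    by (intro CollectI exI[of _ 0] exI[of _ UNIV]) simp
  from Union_upper[OF this] show ?thesis
    by (simp only: vimage_UNIV top.extremum_unique)
qed

lemma topspace_weak_topology [simp]: "topspace weak_topology = UNIV"
  by (simp add: weak_topology_def topology_generated_by_topspace Union_weak_subbase)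

lemma closedin_weak_topology_le:
  fixes f :: "'a::real_normed_vector \<Rightarrow>\<^sub>L real"
  shows "closedin weak_topology {x. f x \<le> c}"
proof -
  have "openin weak_topology (f -` {c<..})"
    unfolding weak_topology_def
    by (intro topology_generated_by_Basis CollectI exI[of _ f] exI[of _ "{c<..}"]) simp
  moreover have "UNIV - {x. f x \<le> c} = f -` {c<..}" by auto
  ultimately show ?thesis by (simp add: closedin_def)
qed

text \<open>The norm topology is finer than the weak one, so the identity is continuous and carries
  compact sets to weakly compact ones.\<close>

lemma compactin_weak_topology_if_compact:
  fixes S :: "'a::real_normed_vector set"
  assumes "compact S" shows "compactin weak_topology S"
proof -
  have "continuous_map euclidean weak_topology (id :: 'a \<Rightarrow> 'a)"
    unfolding weak_topology_def
  proof (rule continuous_on_generated_topo)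
    show "id ` topspace euclidean \<subseteq> \<Union> {blinfun_apply f -` U |(f :: 'a \<Rightarrow>\<^sub>L real) U. open U}"
      by (simp add: Union_weak_subbase)
    fix W assume "W \<in> {blinfun_apply f -` U |(f :: 'a \<Rightarrow>\<^sub>L real) U. open U}"
    then obtain f :: "'a \<Rightarrow>\<^sub>L real" and U where "W = f -` U" "open U" by blast
    then show "openin euclidean (id -` W \<inter> topspace euclidean)"
      by (simp add: open_vimage blinfun.continuous_on continuous_on_id)
  qed
  then show ?thesis
    using image_compactin[of euclidean S weak_topology id] assms by simp
qed

text \<open>A Banach-Alaoglu argument in the bidual: a bounded piece of it is compact for pointwise
  convergence, reflexivity identifies that piece with points of the space, and \<open>K\<close> is a
  weakly closed part of the result.\<close>

lemma compactin_weak_topology_if_reflexive: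
  fixes K :: "'a::real_normed_vector set"
  assumes refl: "reflexive_banach TYPE('a)"
    and K: "closedin weak_topology K" "bounded K"
  shows "compactin weak_topology K"
proof -
  obtain M where M: "\<And>x. x \<in> K \<Longrightarrow> norm x \<le> M"
    using \<open>bounded K\<close> by (auto simp: bounded_iff)
  \<comment> \<open>The canonical embedding again, now into all functions on the dual, whose
    topology is the product topology.\<close>
  define J :: "'a \<Rightarrow> ('a \<Rightarrow>\<^sub>L real) \<Rightarrow> real" where "J x f = f x" for x f
  have "inj J"
    by (rule injI, rule blinfun_separates_points) (metis J_def)
  \<comment> \<open>Linear forms \<open>u\<close> on the dual with
    \<open>\<bar>u f\<bar> \<le> M * norm f\<close>. Linearity is a closed condition on coordinates,
    so \<open>L\<close> is closed in a compact product of intervals.\<close>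
  define L :: "(('a \<Rightarrow>\<^sub>L real) \<Rightarrow> real) set" where
    "L = (\<Pi>\<^sub>E f\<in>UNIV. {- (M * norm f)..M * norm f}) \<inter>
       {u. (\<forall>f g. u (f + g) = u f + u g) \<and> (\<forall>c f. u (c *\<^sub>R f) = c * u f)}"
  have "compactin (product_topology (\<lambda>f :: 'a \<Rightarrow>\<^sub>L real. euclideanreal) UNIV)
      (\<Pi>\<^sub>E f\<in>UNIV. {- (M * norm f)..M * norm f})"
    by (simp only: compactin_PiE compactin_euclidean_iff compact_Icc) simp
  then have "compact L"
    unfolding L_def euclidean_product_topology compactin_euclidean_iff
    by (intro compact_Int_closed closed_Collect_conj closed_Collect_all closed_Collect_eq
      continuous_intros continuous_on_product_coordinates)
  \<comment> \<open>Reflexivity enters here: each \<open>u\<close> in \<open>L\<close> is a bounded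
    functional on the dual, hence evaluation at a point.\<close>
  have "L \<subseteq> range J"
  proof
    fix u assume u: "u \<in> L"
    then have bd: "\<bar>u f\<bar> \<le> norm f * M" for f
      by (auto simp: L_def PiE_iff abs_le_iff mult.commute minus_le_iff)
    have ap: "blinfun_apply (Blinfun u) = u"
      using u bd by (intro bounded_linear_Blinfun_apply bounded_linear_intro) (auto simp: L_def)
    obtain x where "Blinfun u = bidual_embedding x"
      using refl unfolding reflexive_banach_def by (metis surjD)
    then have "u = J x"
      using ap by (auto simp: J_def fun_eq_iff bidual_embedding.rep_eq)
    then show "u \<in> range J" by simp
  qed
  then have inv_L: "f (inv J u) = u f" if "u \<in> L" for u and f :: "'a \<Rightarrow>\<^sub>L real"
    using f_inv_into_f[of u J UNIV] that by (metis J_def subsetD)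
  have "continuous_map (subtopology euclidean L) weak_topology (inv J)"
    unfolding weak_topology_def
  proof (rule continuous_on_generated_topo)
    fix W assume "W \<in> {blinfun_apply f -` U |(f :: 'a \<Rightarrow>\<^sub>L real) U. open U}"
    then obtain f :: "'a \<Rightarrow>\<^sub>L real" and U where W: "W = f -` U" "open U" by blast
    \<comment> \<open>A subbasic weakly open set pulls back to a condition on the single coordinate
      \<open>f\<close>.\<close>
    have "inv J -` W \<inter> topspace (subtopology euclidean L) = L \<inter> (\<lambda>u. u f) -` U"
      using inv_L W by auto
    moreover have "open ((\<lambda>u. u f) -` U)"
      using W by (intro open_vimage continuous_on_product_coordinates)
    ultimately show "openin (subtopology euclidean L) (inv J -` W \<inter> topspace (subtopology euclidean L))"
      by (auto simp: openin_open)
  next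
    show "inv J ` topspace (subtopology euclidean L) \<subseteq> \<Union> {blinfun_apply f -` U |(f :: 'a \<Rightarrow>\<^sub>L real) U. open U}"
      by (simp add: Union_weak_subbase)
  qed
  moreover have "compactin (subtopology euclidean L) L"
    using \<open>compact L\<close> unfolding compactin_subtopology compactin_euclidean_iff by simp
  ultimately have "compactin weak_topology (inv J ` L)"
    by (rule image_compactin[rotated])
  moreover have "K \<subseteq> inv J ` L"
  proof
    fix x assume "x \<in> K"
    have "\<bar>f x\<bar> \<le> M * norm f" for f :: "'a \<Rightarrow>\<^sub>L real"
      using norm_blinfun[of f x] mult_right_mono[OF M[OF \<open>x \<in> K\<close>], of "norm f"]
      by (simp add: mult.commute)
    then have "J x \<in> L"
      by (auto simp: L_def J_def PiE_iff abs_le_iff minus_le_iff blinfun.add_left blinfun.scaleR_left)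
    then show "x \<in> inv J ` L"
      using inv_f_f[OF \<open>inj J\<close>] by (metis imageI)
  qed
  ultimately show ?thesis
    using compact_Int_closedin[OF _ K(1)] by (metis inf.absorb2)
qed

section \<open>Existence of an optimal centre and radius\<close>

theorem theorem2p4:
  fixes F \<Omega> :: "'a::real_normed_vector set"
    and T :: "nat \<Rightarrow> 'a set"
    and n :: nat
  assumes F: "closed F" "bounded F" "convex F" "0 \<in> interior F"
    and n: "n \<ge> 1"
    and T: "\<And>i. i \<in> {1..n} \<Longrightarrow> T i \<noteq> {} \<and> closed (T i) \<and> bounded (T i)"
    and \<Omega>: "\<Omega> \<noteq> {}" "closed \<Omega>"
    and alternatives: "(\<Omega> \<noteq> {} \<and> compact \<Omega>) \<or>
           (reflexive_banach TYPE('a) \<and> closedin weak_topology \<Omega>)"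
  shows "\<exists>x\<^sub>0\<in>\<Omega>. \<exists>r\<ge>0.
           (\<forall>i\<in>{1..n}. T i \<subseteq> dilate x\<^sub>0 r F) \<and>
           (\<forall>x\<in>\<Omega>. \<forall>t\<ge>0. (\<forall>i\<in>{1..n}. T i \<subseteq> dilate x t F) \<longrightarrow> r \<le> t)"
proof -
  \<comment> \<open>With inequalities in place of \<open>dilate\<close>, monotonicity in
    \<open>t\<close>, weak closedness and the passage to an infimum can be read off. The link to
    \<open>dilate\<close> is made for \<open>0 \<le> t\<close> only.\<close>
  define C where "C t = {x. \<forall>i\<in>{1..n}. \<forall>z\<in>T i. \<forall>f\<in>polar F. blinfun_apply f z - f x \<le> t}" for t
  have C_iff: "x \<in> C t \<longleftrightarrow> (\<forall>i\<in>{1..n}. T i \<subseteq> dilate x t F)" if "0 \<le> t" for x t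
    using mem_dilate_iff_polar[OF F that] by (auto simp: C_def)
  have C_mono: "C s \<subseteq> C t" if "s \<le> t" for s t
    using that by (force simp: C_def)
  have C_closed: "closedin weak_topology (C t)" for t
  proof -
    \<comment> \<open>Inserting \<open>UNIV\<close> makes the family visibly nonempty, as
      \<open>closedin_Inter\<close> demands.\<close>
    have C_eq: "C t = \<Inter> (insert UNIV ((\<lambda>(z, f). {x. blinfun_apply f x \<ge> f z - t}) `
        ((\<Union>i\<in>{1..n}. T i) \<times> polar F)))"
      by (auto simp: C_def algebra_simps)
    have "closedin weak_topology {x. blinfun_apply f x \<ge> c}" for f :: "'a \<Rightarrow>\<^sub>L real" and c
      using closedin_weak_topology_le[of "- f" "- c"] by (simp add: blinfun.minus_left)
    moreover have "closedin weak_topology UNIV"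
      using closedin_topspace[of weak_topology] by simp
    ultimately show ?thesis unfolding C_eq by (intro closedin_Inter) auto
  qed
  define A where "A = {t. 0 \<le> t \<and> \<Omega> \<inter> C t \<noteq> {}}"
  obtain a where a: "a \<in> \<Omega>" using \<Omega> by blast
  obtain d where d: "0 < d" "cball 0 d \<subseteq> F"
    using F(4) by (auto simp: mem_interior_cball)
  have "bounded (\<Union>i\<in>{1..n}. T i)"
    using T by (intro bounded_UN) blast+
  then obtain b where b: "0 < b" "\<And>i z. i \<in> {1..n} \<Longrightarrow> z \<in> T i \<Longrightarrow> norm z \<le> b"
    unfolding bounded_pos by blast
  \<comment> \<open>Every target point is within \<open>b + norm a\<close> of \<open>a\<close>, and
    \<open>t\<^sub>0\<close> scales the ball of radius \<open>d\<close> in \<open>F\<close> to that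
    size; so \<open>t\<^sub>0\<close> is feasible.\<close>
  define t\<^sub>0 where "t\<^sub>0 = (b + norm a) / d"
  have t\<^sub>0: "0 < t\<^sub>0" "b + norm a = t\<^sub>0 * d"
    using add_pos_nonneg[OF b(1) norm_ge_zero, of a] d(1) by (simp_all add: t\<^sub>0_def)
  have "T i \<subseteq> dilate a t\<^sub>0 F" if i: "i \<in> {1..n}" for i
  proof
    fix z assume "z \<in> T i"
    then have "norm (z - a) \<le> t\<^sub>0 * d"
      using norm_triangle_ineq4[of z a] b(2)[OF i] t\<^sub>0(2) by fastforce
    moreover have "norm ((z - a) /\<^sub>R t\<^sub>0) = norm (z - a) / t\<^sub>0"
      using t\<^sub>0(1) by (simp add: divide_inverse_commute)
    ultimately have "norm ((z - a) /\<^sub>R t\<^sub>0) \<le> d"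
      using t\<^sub>0(1) by (simp only: pos_divide_le_eq mult.commute)
    then have "(z - a) /\<^sub>R t\<^sub>0 \<in> F"
      by (intro subsetD[OF d(2)]) (simp only: mem_cball_0)
    moreover have "z = a + t\<^sub>0 *\<^sub>R ((z - a) /\<^sub>R t\<^sub>0)" using t\<^sub>0 by simp
    ultimately show "z \<in> dilate a t\<^sub>0 F" unfolding dilate_def by blast
  qed
  then have "a \<in> C t\<^sub>0" using C_iff t\<^sub>0(1) by simp
  with a t\<^sub>0(1) have "t\<^sub>0 \<in> A" by (auto simp: A_def)
  have "bounded (C t\<^sub>0)"
  proof -
    \<comment> \<open>One target point suffices: an admissible centre differs from \<open>z\<close>
      by \<open>t\<^sub>0\<close> times an element of the bounded set \<open>F\<close>.\<close>
    obtain z where z: "z \<in> T 1" using T[of 1] n by auto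
    obtain b where b: "\<And>y. y \<in> F \<Longrightarrow> norm y \<le> b"
      using \<open>bounded F\<close> by (auto simp: bounded_iff)
    have "norm x \<le> norm z + t\<^sub>0 * b" if "x \<in> C t\<^sub>0" for x
    proof -
      have "z \<in> dilate x t\<^sub>0 F" using that z n t\<^sub>0(1) C_iff[of t\<^sub>0 x] by auto
      then obtain y where y: "y \<in> F" "x = z - t\<^sub>0 *\<^sub>R y" by (auto simp: dilate_def)
      have "norm x \<le> norm z + norm (t\<^sub>0 *\<^sub>R y)"
        unfolding y(2) by (rule norm_triangle_ineq4)
      also have "norm (t\<^sub>0 *\<^sub>R y) \<le> t\<^sub>0 * b"
        using b[OF y(1)] t\<^sub>0(1) by simp
      finally show ?thesis by simp
    qed
    then show ?thesis by (auto simp: bounded_iff)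
  qed
  from alternatives have K: "compactin weak_topology (\<Omega> \<inter> C t\<^sub>0)"
  proof
    assume "\<Omega> \<noteq> {} \<and> compact \<Omega>"
    then show ?thesis
      by (intro compact_Int_closedin C_closed compactin_weak_topology_if_compact) simp
  next
    assume "reflexive_banach TYPE('a) \<and> closedin weak_topology \<Omega>"
    with \<open>bounded (C t\<^sub>0)\<close> show ?thesis
      by (intro compactin_weak_topology_if_reflexive closedin_Int C_closed) auto
  qed
  have "\<Omega> \<inter> C t\<^sub>0 \<inter> \<Inter> (C ` A) \<noteq> {}"
  proof (rule compactin_fip[THEN iffD1, OF K, THEN conjunct2, rule_format], intro conjI ballI allI impI)
    fix S assume "S \<in> C ` A"
    then show "closedin weak_topology S" using C_closed by blast
  next
    fix \<F> assume "finite \<F> \<and> \<F> \<subseteq> C ` A"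
    then obtain A' where A': "A' \<subseteq> A" "finite A'" "\<F> = C ` A'"
      by (meson finite_subset_image)
    \<comment> \<open>Including \<open>t\<^sub>0\<close> covers the empty subfamily and places the
      witness in \<open>C t\<^sub>0\<close>; the smallest radius works for all others by
      monotonicity.\<close>
    define m where "m = Min (insert t\<^sub>0 A')"
    have "m \<in> insert t\<^sub>0 A'" unfolding m_def using A'(2) by (intro Min_in) auto
    then have "m \<in> A" using A'(1) \<open>t\<^sub>0 \<in> A\<close> by auto
    then obtain x where x: "x \<in> \<Omega>" "x \<in> C m" by (auto simp: A_def)
    have "x \<in> C t" if "t \<in> insert t\<^sub>0 A'" for t
      using C_mono[of m t] x(2) that A'(2) by (auto simp: m_def)
    with x A'(3) show "\<Omega> \<inter> C t\<^sub>0 \<inter> \<Inter> \<F> \<noteq> {}" by auto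
  qed
  then obtain x\<^sub>0 where x\<^sub>0: "x\<^sub>0 \<in> \<Omega>" "\<And>t. t \<in> A \<Longrightarrow> x\<^sub>0 \<in> C t" by blast
  define r where "r = Inf A"
  have "0 \<le> r"
    unfolding r_def using \<open>t\<^sub>0 \<in> A\<close> by (intro cInf_greatest) (auto simp: A_def)
  have r_le: "r \<le> t" if "t \<in> A" for t
    unfolding r_def using that by (intro cInf_lower) (auto simp: A_def intro!: bdd_belowI[of _ 0])
  \<comment> \<open>Each single inequality holds with every \<open>t\<close> in \<open>A\<close> on
    the right, hence with the infimum, so the infimum is attained.\<close>
  have "x\<^sub>0 \<in> C r"
    unfolding C_def
  proof (intro CollectI ballI)
    fix i z f assume "i \<in> {1..n}" "z \<in> T i" "f \<in> polar F"
    then show "f z - f x\<^sub>0 \<le> r"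
      unfolding r_def using x\<^sub>0(2) \<open>t\<^sub>0 \<in> A\<close> by (intro cInf_greatest) (auto simp: C_def)
  qed
  show ?thesis
  proof (intro bexI exI conjI ballI allI impI)
    show "T i \<subseteq> dilate x\<^sub>0 r F" if "i \<in> {1..n}" for i
      using \<open>x\<^sub>0 \<in> C r\<close> C_iff[OF \<open>0 \<le> r\<close>] that by blast
    show "r \<le> t" if "x \<in> \<Omega>" "0 \<le> t" "\<forall>i\<in>{1..n}. T i \<subseteq> dilate x t F" for x t
      using that by (intro r_le) (auto simp: A_def C_iff)
  qed (use \<open>0 \<le> r\<close> x\<^sub>0 in auto)
qed

end
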